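(* Let $\mu,\rho\in\mathbb{R}\setminus\{0\}$ be such that $\mu\rho<\frac14$. Let $c=\frac{1}{2\rho}$ and $r=\frac{\sqrt{1-4\mu\rho}}{2|\rho|}$. Then the SRG of the class $\mathcal{S}_{\mu,\rho}$ of $(\mu,\rho)$-semimonotone operators is $$G(\mathcal{S}_{\mu,\rho})=\begin{cases}\overline{\mathbb{C}}\setminus D(c,r)&\text{if }\rho<0,\\ \operatorname{cl}D(c,r)&\text{if }\rho>0.\end{cases}$$
   Context: Hilbert spaces are real. For a set-valued operator $A:\mathcal{H}\rightrightarrows\mathcal{H}$ on a Hilbert space, its graph is $\operatorname{gph}A=\{(x,u)\in\mathcal{H}\times\mathcal{H}: u\in A(x)\}$. An operator class is a set of set-valued operators on Hilbert spaces (different members may act on different Hilbert spaces). Semimonotonicity: $A:\mathcal{H}\rightrightarrows\mathcal{H}$ is $(\mu,\rho)$-semimonotone if $\langle x-y,u-v\rangle\ge\mu\|x-y\|^2+\rho\|u-v\|^2$ for all $(x,u),(y,v)\in\operatorname{gph}A$. $\mathcal{S}_{\mu,\rho}$ denotes the class of all $(\mu,\rho)$-semimonotone operators (on all Hilbert spaces). Scaled relative graph (SRG): let $\overline{\mathbb{C}}=\mathbb{C}\cup\{\infty\}$. For $a,b\in\mathcal{H}$ let $\angle(a,b)=\arccos\left(\frac{\langle a,b\rangle}{\|a\|\|b\|}\right)$ if $a\ne0$ and $b\ne0$, and $\angle(a,b)=0$ otherwise; for $a\neq 0$ let $z_\pm(a,b)=\frac{\|b\|}{\|a\|}\exp(\pm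 i\angle(a,b))$. The SRG of an operator $A$ is $G(A)=\{z_{\pm}(x-y,u-v): u\in A(x),\,v\in A(y),\,x\ne y\}$ (both signs included), together with the point $\infty$ if $A$ is multi-valued (i.e. $A(x)$ has more than one element for some $x$). The SRG of an operator class $\mathcal{A}$ is $G(\mathcal{A})=\bigcup_{A\in\mathcal{A}}G(A)$. $D(c,r)=\{z\in\mathbb{C}:|z-c|<r\}$ is the open disk and $\operatorname{cl}D(c,r)$ its closure, the closed disk in $\mathbb{C}$. *)

theory Defs
  imports "HOL-Analysis.Analysis" "HOL-Algebra.Module" "HOL-Library.Equipollence"
begin

text \<open>
  A type-class Hilbert space has a whole type as its point set, and a class of operators over
  type-class spaces could not have members acting on different spaces.  Hilbert spaces are
  therefore carrier-based structures, as in \<^theory>\<open>HOL-Algebra.Module\<close>, whose points are drawn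
  from a type \<open>'a\<close>.  That type is an arbitrary universe from which the points of ``all Hilbert
  spaces'' are taken: every Hilbert space with at most as many points as \<open>'a\<close> has an isometric copy
  there.  Below the cardinality of the continuum it contains at most the zero space.
\<close>

definition real_ring :: "real ring" where
  "real_ring = \<lparr>carrier = UNIV, mult = (*), one = 1, zero = 0, add = (+)\<rparr>"

text \<open>The fields \<open>mult\<close> and \<open>one\<close>, inherited from the record of modules, are irrelevant.\<close>

record 'a hilbert = "(real, 'a) module" +
  ip :: "'a \<Rightarrow> 'a \<Rightarrow> real"

definition hnorm :: "'a hilbert \<Rightarrow> 'a \<Rightarrow> real" where
  "hnorm H x = sqrt (ip H x x)"

text \<open>
  \<^const>\<open>Metric_space\<close> demands symmetry and nonnegativity also outside of the carrier, hence the
  value \<open>0\<close> there.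
\<close>

definition hdist :: "'a hilbert \<Rightarrow> 'a \<Rightarrow> 'a \<Rightarrow> real" where
  "hdist H x y = (if x \<in> carrier H \<and> y \<in> carrier H then hnorm H (x \<ominus>\<^bsub>H\<^esub> y) else 0)"

locale real_inner_space = Module.module real_ring H for H :: "'a hilbert" (structure) +
  assumes ip_commute: "\<lbrakk>x \<in> carrier H; y \<in> carrier H\<rbrakk> \<Longrightarrow> ip H x y = ip H y x"
    and ip_add_left:
      "\<lbrakk>x \<in> carrier H; y \<in> carrier H; z \<in> carrier H\<rbrakk> \<Longrightarrow> ip H (x \<oplus> y) z = ip H x z + ip H y z"
    and ip_smult_left:
      "\<lbrakk>x \<in> carrier H; y \<in> carrier H\<rbrakk> \<Longrightarrow> ip H (a \<odot>\<^bsub>H\<^esub> x) y = a * ip H x y"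
    and ip_nonneg: "x \<in> carrier H \<Longrightarrow> 0 \<le> ip H x x"
    and ip_eq_zero_iff: "x \<in> carrier H \<Longrightarrow> ip H x x = 0 \<longleftrightarrow> x = \<zero>"

locale real_hilbert_space = real_inner_space +
  assumes complete: "Metric_space.mcomplete (carrier H) (hdist H)"

definition angle :: "'a hilbert \<Rightarrow> 'a \<Rightarrow> 'a \<Rightarrow> real" where
  "angle H a b =
     (if a \<noteq> \<zero>\<^bsub>H\<^esub> \<and> b \<noteq> \<zero>\<^bsub>H\<^esub> then arccos (ip H a b / (hnorm H a * hnorm H b)) else 0)"

definition z_plus :: "'a hilbert \<Rightarrow> 'a \<Rightarrow> 'a \<Rightarrow> complex" where
  "z_plus H a b = of_real (hnorm H b / hnorm H a) * exp (\<i> * of_real (angle H a b))"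

definition z_minus :: "'a hilbert \<Rightarrow> 'a \<Rightarrow> 'a \<Rightarrow> complex" where
  "z_minus H a b = of_real (hnorm H b / hnorm H a) * exp (- \<i> * of_real (angle H a b))"

text \<open>An operator is a set-valued map together with the space it acts on.\<close>

type_synonym 'a operator = "'a hilbert \<times> ('a \<Rightarrow> 'a set)"

definition operators :: "'a operator set" where
  "operators = {(H, A). real_hilbert_space H \<and> A \<in> carrier H \<rightarrow> Pow (carrier H)}"

definition gph :: "'a operator \<Rightarrow> ('a \<times> 'a) set" where
  "gph = (\<lambda>(H, A). {(x, u). x \<in> carrier H \<and> u \<in> carrier H \<and> u \<in> A x})"

definition semimonotone :: "real \<Rightarrow> real \<Rightarrow> 'a operator \<Rightarrow> bool" where
  "semimonotone \<mu> \<rho> = (\<lambda>(H, A). \<forall>(x, u) \<in> gph (H, A). \<forall>(y, v) \<in> gph (H, A).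
     ip H (x \<ominus>\<^bsub>H\<^esub> y) (u \<ominus>\<^bsub>H\<^esub> v) \<ge> \<mu> * (hnorm H (x \<ominus>\<^bsub>H\<^esub> y))\<^sup>2 + \<rho> * (hnorm H (u \<ominus>\<^bsub>H\<^esub> v))\<^sup>2)"

definition semimonotone_class :: "real \<Rightarrow> real \<Rightarrow> 'a operator set" where
  "semimonotone_class \<mu> \<rho> = {A \<in> operators. semimonotone \<mu> \<rho> A}"

text \<open>
  As in \<^const>\<open>Alexandroff_compactification\<close>, the one-point extension of the complex plane is
  rendered by the option type, with \<^const>\<open>None\<close> as the point at infinity.
\<close>

type_synonym ext_complex = "complex option"

definition SRG :: "'a operator \<Rightarrow> ext_complex set" where
  "SRG = (\<lambda>(H, A).
     {Some z | z x y u v. (x, u) \<in> gph (H, A) \<and> (y, v) \<in> gph (H, A) \<and> x \<noteq> y \<and>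
        z \<in> {z_plus H (x \<ominus>\<^bsub>H\<^esub> y) (u \<ominus>\<^bsub>H\<^esub> v), z_minus H (x \<ominus>\<^bsub>H\<^esub> y) (u \<ominus>\<^bsub>H\<^esub> v)}} \<union>
     (if \<exists>x u v. (x, u) \<in> gph (H, A) \<and> (x, v) \<in> gph (H, A) \<and> u \<noteq> v then {None} else {}))"

definition SRG_class :: "'a operator set \<Rightarrow> ext_complex set" where
  "SRG_class \<A> = (\<Union>A\<in>\<A>. SRG A)"

context real_inner_space
begin

lemma minus_eq_smult: "y \<in> carrier H \<Longrightarrow> \<ominus> y = (- 1) \<odot>\<^bsub>H\<^esub> y"
proof -
  assume y: "y \<in> carrier H"
  have "\<ominus>\<^bsub>real_ring\<^esub> \<one>\<^bsub>real_ring\<^esub> = - 1"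
    by (rule R.minus_equality) (auto simp: real_ring_def)
  moreover have "(\<ominus>\<^bsub>real_ring\<^esub> \<one>\<^bsub>real_ring\<^esub>) \<odot>\<^bsub>H\<^esub> y = \<ominus> (\<one>\<^bsub>real_ring\<^esub> \<odot>\<^bsub>H\<^esub> y)"
    by (rule smult_l_minus) (auto simp: y)
  ultimately show ?thesis
    using y by simp
qed

lemma smult_in_carrier: "y \<in> carrier H \<Longrightarrow> a \<odot>\<^bsub>H\<^esub> y \<in> carrier H"
  using smult_closed[of a y] by (simp add: real_ring_def)

lemma ip_minus_left:
  assumes "x \<in> carrier H" "y \<in> carrier H" "z \<in> carrier H"
  shows "ip H (x \<ominus> y) z = ip H x z - ip H y z"
  using assms by (simp add: a_minus_def minus_eq_smult ip_add_left ip_smult_left smult_in_carrier)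

lemma ip_minus_right:
  assumes "x \<in> carrier H" "y \<in> carrier H" "z \<in> carrier H"
  shows "ip H z (x \<ominus> y) = ip H z x - ip H z y"
  using assms ip_minus_left[of x y z] by (metis ip_commute minus_closed)

lemma ip_add_right:
  assumes "x \<in> carrier H" "y \<in> carrier H" "z \<in> carrier H"
  shows "ip H z (x \<oplus> y) = ip H z x + ip H z y"
  using assms ip_add_left[of x y z] by (metis ip_commute a_closed)

lemma ip_smult_right:
  assumes "x \<in> carrier H" "y \<in> carrier H"
  shows "ip H y (a \<odot>\<^bsub>H\<^esub> x) = a * ip H y x"
  using assms ip_smult_left[of x y a] by (metis ip_commute smult_in_carrier)

lemma Cauchy_Schwarz:
  assumes x: "x \<in> carrier H" and y: "y \<in> carrier H"
  shows "\<bar>ip H x y\<bar> \<le> hnorm H x * hnorm H y"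
proof -
  let ?a = "ip H x x" and ?b = "ip H y y" and ?c = "ip H x y"
  define w where "w = ?b \<odot>\<^bsub>H\<^esub> x \<ominus> ?c \<odot>\<^bsub>H\<^esub> y"
  have "?c\<^sup>2 \<le> ?a * ?b"
  proof (cases "?b = 0")
    case True
    then have "y = 0 \<odot>\<^bsub>H\<^esub> y"
      using y by (simp add: ip_eq_zero_iff) (metis a_minus_def ip_eq_zero_iff ip_smult_left 
        mult_zero_left smult_in_carrier zero_closed)
    then have "?c = 0"
      using x y by (metis ip_smult_right mult_zero_left)
    then show ?thesis
      using True by simp
  next
    case False
    have "ip H w w = ?b * (?a * ?b - ?c\<^sup>2)"
      using x y ip_commute[OF y x]
      by (simp add: w_def ip_minus_left ip_minus_right ip_smult_left ip_smult_right
          smult_in_carrier algebra_simps power2_eq_square)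
    moreover have "0 \<le> ip H w w"
      using x y by (simp add: w_def ip_nonneg smult_in_carrier)
    moreover have "0 < ?b"
      using False ip_nonneg[OF y] by simp
    ultimately show ?thesis
      by (simp add: zero_le_mult_iff)
  qed
  then show ?thesis
    unfolding hnorm_def using real_sqrt_le_mono[of "?c\<^sup>2" "?a * ?b"] by (simp add: real_sqrt_mult)
qed

lemma hnorm_triangle:
  assumes x: "x \<in> carrier H" and y: "y \<in> carrier H"
  shows "hnorm H (x \<oplus> y) \<le> hnorm H x + hnorm H y"
proof -
  have "ip H (x \<oplus> y) (x \<oplus> y) = ip H x x + 2 * ip H x y + ip H y y"
    using x y by (simp add: ip_add_left ip_add_right ip_commute)
  also have "\<dots> \<le> (hnorm H x + hnorm H y)\<^sup>2"
    using Cauchy_Schwarz[OF x y] ip_nonneg[OF x] ip_nonneg[OF y]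
    by (simp add: power2_sum hnorm_def)
  finally show ?thesis
    unfolding hnorm_def[of H "x \<oplus> y"] using ip_nonneg x y
    by (intro real_le_lsqrt) (auto simp: hnorm_def)
qed

lemma Metric_space_hdist: "Metric_space (carrier H) (hdist H)"
proof
  show "0 \<le> hdist H x y" for x y
    by (simp add: hdist_def hnorm_def ip_nonneg)
  show "hdist H x y = hdist H y x" for x y
    by (simp add: hdist_def hnorm_def ip_minus_left ip_minus_right)
  show "hdist H x y = 0 \<longleftrightarrow> x = y" if "x \<in> carrier H" "y \<in> carrier H" for x y
  proof -
    have "x \<ominus> y = \<zero> \<longleftrightarrow> x = y"
      using that by (metis M.minus_equality M.minus_minus M.r_neg a_inv_closed minus_eq)
    then show ?thesis
      using that by (simp add: hdist_def hnorm_def ip_eq_zero_iff)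
  qed
  show "hdist H x z \<le> hdist H x y + hdist H y z"
    if "x \<in> carrier H" "y \<in> carrier H" "z \<in> carrier H" for x y z
  proof -
    have "x \<ominus> z = (x \<ominus> y) \<oplus> (y \<ominus> z)"
      using that by (simp add: minus_eq M.a_assoc M.r_neg1)
    then show ?thesis
      using that hnorm_triangle[of "x \<ominus> y" "y \<ominus> z"] by (simp add: hdist_def)
  qed
qed

end

text \<open>Every Hilbert space in the sense of the type classes is an instance.\<close>

definition type_hilbert :: "'h::real_inner hilbert" where
  "type_hilbert = \<lparr>carrier = UNIV, mult = (\<lambda>x y. 0), one = 0, zero = 0, add = (+),
     smult = (*\<^sub>R), ip = (\<bullet>)\<rparr>"

lemma real_hilbert_space_type_hilbert:
  "real_hilbert_space (type_hilbert :: 'h::{real_inner, complete_space} hilbert)"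
proof -
  let ?H = "type_hilbert :: 'h hilbert"
  have inv: "\<exists>y. x + y = 0" for x :: 'h
    by (rule exI[of _ "- x"]) simp
  have inv_real: "\<exists>y. x + y = 0" for x :: real
    by (rule exI[of _ "- x"]) simp
  have ab: "abelian_group ?H"
    by (rule abelian_groupI)
      (auto simp: type_hilbert_def algebra_simps inv)
  have cr: "cring real_ring"
    by (rule cringI) (auto simp: real_ring_def algebra_simps inv_real
        intro!: abelian_groupI comm_monoidI)
  interpret real_inner_space ?H
    by (intro real_inner_space.intro Module.module.intro ab cr Module.module_axioms.intro
        real_inner_space_axioms.intro)
      (auto simp: type_hilbert_def real_ring_def algebra_simps inner_commute)
  have "\<ominus>\<^bsub>?H\<^esub> y = - y" for y
    using minus_eq_smult[of y] by (simp add: type_hilbert_def)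
  then have "hdist ?H = dist"
    by (intro ext) (simp add: hdist_def hnorm_def a_minus_def type_hilbert_def dist_norm norm_eq_sqrt_inner)
  moreover have "Met_TC.mcomplete TYPE('h)"
    by (simp add: complete_UNIV)
  ultimately show ?thesis
    by unfold_locales (simp add: type_hilbert_def)
qed

end

theory Submission
  imports Defs
begin

text \<open>
  Write \<open>a = x - y \<noteq> 0\<close> and \<open>b = u - v\<close> for a pair of points of a graph.  The two numbers
  \<open>z\<^sub>\<plusminus>(a, b)\<close> are exactly the complex numbers \<open>z\<close> with \<open>Re z = \<langle>a, b\<rangle> / \<parallel>a\<parallel>\<^sup>2\<close> and
  \<open>\<bar>z\<bar> = \<parallel>b\<parallel> / \<parallel>a\<parallel>\<close> (lemma \<open>z_plus_z_minus_iff\<close>).  Dividing the semimonotonicity inequality by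
  \<open>\<parallel>a\<parallel>\<^sup>2\<close> therefore turns it into \<open>\<mu> + \<rho> \<bar>z\<bar>\<^sup>2 \<le> Re z\<close>, and completing the square turns that into
  \<open>\<rho> (\<bar>z - c\<bar>\<^sup>2 - r\<^sup>2) \<le> 0\<close> (lemma \<open>disk_inequality\<close>): the closed disk if \<open>\<rho> > 0\<close>, the complement of
  the open disk if \<open>\<rho> < 0\<close>.  If \<open>a = 0\<close>, the inequality reads \<open>\<rho> \<parallel>b\<parallel>\<^sup>2 \<le> 0\<close>, so a semimonotone
  operator with \<open>\<rho> > 0\<close> is single-valued and \<open>\<infinity>\<close> cannot occur.

  Conversely, every point allowed by these inequalities is attained by an operator on the plane
  whose graph has just two points: \<open>{(0, 0), (1, z)}\<close> for a finite point \<open>z\<close>, and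
  \<open>{(0, 0), (0, 1)}\<close> for \<open>\<infinity>\<close>.  The points of the spaces are drawn from a type at least as large as
  the continuum, so that type contains an isometric copy of the plane (\<open>hilbert_copy\<close>), which is
  where these operators act.
\<close>

section \<open>The two points of the scaled relative graph given by a pair of vectors\<close>

lemma eq_or_eq_cnj_iff: "z = w \<or> z = cnj w \<longleftrightarrow> Re z = Re w \<and> cmod z = cmod w"
proof
  assume *: "Re z = Re w \<and> cmod z = cmod w"
  then have "(Re z)\<^sup>2 + (Im z)\<^sup>2 = (Re w)\<^sup>2 + (Im w)\<^sup>2"
    by (metis cmod_power2)
  with * have "Im z = Im w \<or> Im z = - Im w"
    by (simp add: power2_eq_iff)
  with * show "z = w \<or> z = cnj w"
    by (auto simp: complex_eq_iff)
qed auto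

lemma z_minus_eq_cnj: "z_minus H a b = cnj (z_plus H a b)"
  by (simp add: z_plus_def z_minus_def exp_cnj)

context real_inner_space
begin

lemma minus_eq_zero_iff: "x \<in> carrier H \<Longrightarrow> y \<in> carrier H \<Longrightarrow> x \<ominus> y = \<zero> \<longleftrightarrow> x = y"
  by (metis M.minus_equality M.minus_minus M.r_neg a_inv_closed minus_eq)

lemma hnorm_eq_zero_iff: "x \<in> carrier H \<Longrightarrow> hnorm H x = 0 \<longleftrightarrow> x = \<zero>"
  by (simp add: hnorm_def ip_eq_zero_iff)

lemma hnorm_nonneg: "x \<in> carrier H \<Longrightarrow> 0 \<le> hnorm H x"
  by (simp add: hnorm_def ip_nonneg)

lemma ip_zero_left: "y \<in> carrier H \<Longrightarrow> ip H \<zero> y = 0"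
  using ip_add_left[of \<zero> \<zero> y] by simp

text \<open>
  By the Cauchy-Schwarz inequality the argument of \<open>arccos\<close> lies in its domain, so the cosine of
  the angle is the normalised inner product.  For \<open>b = 0\<close> both sides are \<open>0\<close>, whatever the angle.
\<close>

lemma norm_mult_cos_angle:
  assumes a: "a \<in> carrier H" and b: "b \<in> carrier H" and "a \<noteq> \<zero>"
  shows "hnorm H a * hnorm H b * cos (angle H a b) = ip H a b"
proof (cases "b = \<zero>")
  case True
  then show ?thesis
    using a ip_zero_left[of a] ip_commute[of a b] hnorm_eq_zero_iff[of b] by simp
next
  case False
  let ?p = "hnorm H a * hnorm H b"
  have p: "0 < ?p"
    using assms False hnorm_eq_zero_iff hnorm_nonneg by (simp add: less_le)
  have "\<bar>ip H a b / ?p\<bar> \<le> 1"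
    using Cauchy_Schwarz[OF a b] p by simp
  then have "cos (angle H a b) = ip H a b / ?p"
    using \<open>a \<noteq> \<zero>\<close> False by (simp add: angle_def cos_arccos_abs)
  then show ?thesis
    using p by (auto simp: field_simps)
qed

lemma z_plus_z_minus_iff:
  assumes a: "a \<in> carrier H" and b: "b \<in> carrier H" and nz: "a \<noteq> \<zero>"
  shows "z \<in> {z_plus H a b, z_minus H a b} \<longleftrightarrow>
    Re z = ip H a b / (hnorm H a)\<^sup>2 \<and> cmod z = hnorm H b / hnorm H a"
proof -
  have "hnorm H a \<noteq> 0"
    using a nz by (simp add: hnorm_eq_zero_iff)
  have "Re (z_plus H a b) = hnorm H b / hnorm H a * cos (angle H a b)"
    by (simp add: z_plus_def Re_exp)
  also have "\<dots> = ip H a b / (hnorm H a)\<^sup>2"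
    using \<open>hnorm H a \<noteq> 0\<close>
    by (simp add: norm_mult_cos_angle[OF assms, symmetric] power2_eq_square)
  finally have "Re (z_plus H a b) = ip H a b / (hnorm H a)\<^sup>2" .
  moreover have "cmod (z_plus H a b) = hnorm H b / hnorm H a"
    using hnorm_nonneg[OF a] hnorm_nonneg[OF b]
    by (simp add: z_plus_def norm_mult norm_divide)
  ultimately show ?thesis
    using eq_or_eq_cnj_iff[of z "z_plus H a b"] by (simp add: z_minus_eq_cnj)
qed

end

section \<open>The region of the plane cut out by semimonotonicity\<close>

lemma disk_inequality:
  fixes \<mu> \<rho> c r :: real
  assumes "\<rho> \<noteq> 0" "\<mu> * \<rho> < 1 / 4" "c = 1 / (2 * \<rho>)" "r = sqrt (1 - 4 * \<mu> * \<rho>) / (2 * \<bar>\<rho>\<bar>)"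
  shows "\<mu> + \<rho> * (cmod z)\<^sup>2 \<le> Re z \<longleftrightarrow>
    (if \<rho> < 0 then z \<notin> ball (complex_of_real c) r else z \<in> cball (complex_of_real c) r)"
proof -
  let ?d = "dist (complex_of_real c) z"
  have r: "0 \<le> r" and r2: "r\<^sup>2 = (1 - 4 * \<mu> * \<rho>) / (4 * \<rho>\<^sup>2)"
    using assms by (auto simp: power_divide power_mult_distrib)
  have d2: "?d\<^sup>2 = (Re z - c)\<^sup>2 + (Im z)\<^sup>2"
    by (simp add: dist_commute dist_norm cmod_power2)
  have "\<rho> * (?d\<^sup>2 - r\<^sup>2) = \<mu> + \<rho> * (cmod z)\<^sup>2 - Re z"
    unfolding d2 r2 cmod_power2 unfolding assms(3) using assms(1)
    by (simp add: field_simps power2_eq_square)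
  then have "\<mu> + \<rho> * (cmod z)\<^sup>2 \<le> Re z \<longleftrightarrow> \<rho> * (?d\<^sup>2 - r\<^sup>2) \<le> 0"
    by simp
  also have "\<dots> \<longleftrightarrow> (if \<rho> < 0 then r\<^sup>2 \<le> ?d\<^sup>2 else ?d\<^sup>2 \<le> r\<^sup>2)"
    using assms(1) by (auto simp: mult_le_0_iff)
  also have "\<dots> \<longleftrightarrow> (if \<rho> < 0 then r \<le> ?d else ?d \<le> r)"
    using r by (simp add: abs_le_square_iff[symmetric])
  finally show ?thesis
    by (simp add: not_less)
qed

lemma Some_in_SRG_semimonotone:
  assumes A: "A \<in> semimonotone_class \<mu> \<rho>" and z: "Some z \<in> SRG A"
  shows "\<mu> + \<rho> * (cmod z)\<^sup>2 \<le> Re z"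
proof -
  obtain H F where AHF: "A = (H, F)"
    by (cases A)
  then interpret real_hilbert_space H
    using A by (simp add: semimonotone_class_def operators_def)
  obtain x y u v where xu: "(x, u) \<in> gph (H, F)" and yv: "(y, v) \<in> gph (H, F)" and "x \<noteq> y"
    and zpm: "z \<in> {z_plus H (x \<ominus>\<^bsub>H\<^esub> y) (u \<ominus>\<^bsub>H\<^esub> v), z_minus H (x \<ominus>\<^bsub>H\<^esub> y) (u \<ominus>\<^bsub>H\<^esub> v)}"
    using z unfolding AHF SRG_def by (auto split: if_splits)
  let ?a = "x \<ominus>\<^bsub>H\<^esub> y" and ?b = "u \<ominus>\<^bsub>H\<^esub> v"
  have car: "x \<in> carrier H" "u \<in> carrier H" "y \<in> carrier H" "v \<in> carrier H"
    using xu yv by (auto simp: gph_def)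
  have nz: "?a \<noteq> \<zero>\<^bsub>H\<^esub>"
    using car \<open>x \<noteq> y\<close> by (simp add: minus_eq_zero_iff)
  then have pos: "0 < (hnorm H ?a)\<^sup>2"
    using car by (simp add: hnorm_eq_zero_iff)
  have "\<mu> * (hnorm H ?a)\<^sup>2 + \<rho> * (hnorm H ?b)\<^sup>2 \<le> ip H ?a ?b"
    using A xu yv by (fastforce simp: AHF semimonotone_class_def semimonotone_def)
  then have "(\<mu> * (hnorm H ?a)\<^sup>2 + \<rho> * (hnorm H ?b)\<^sup>2) / (hnorm H ?a)\<^sup>2
      \<le> ip H ?a ?b / (hnorm H ?a)\<^sup>2"
    using pos by (simp add: divide_right_mono)
  moreover have "Re z = ip H ?a ?b / (hnorm H ?a)\<^sup>2" "cmod z = hnorm H ?b / hnorm H ?a"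
    using zpm z_plus_z_minus_iff[OF _ _ nz, of ?b z] car by auto
  ultimately show ?thesis
    using pos by (simp add: add_divide_distrib power_divide)
qed

text \<open>
  Two values of the operator at the same point have \<open>a = 0\<close>, so the inner product and the term with
  \<open>\<mu>\<close> vanish.
\<close>

lemma None_in_SRG_semimonotone:
  assumes A: "A \<in> semimonotone_class \<mu> \<rho>" and "None \<in> SRG A"
  shows "\<rho> \<le> 0"
proof -
  obtain H F where AHF: "A = (H, F)"
    by (cases A)
  then interpret real_hilbert_space H
    using A by (simp add: semimonotone_class_def operators_def)
  obtain x u v where xu: "(x, u) \<in> gph (H, F)" and xv: "(x, v) \<in> gph (H, F)" and "u \<noteq> v"
    using assms(2) unfolding AHF SRG_def by (auto split: if_splits)
  have car: "x \<in> carrier H" "u \<in> carrier H" "v \<in> carrier H"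
    using xu xv by (auto simp: gph_def)
  have "x \<ominus>\<^bsub>H\<^esub> x = \<zero>\<^bsub>H\<^esub>"
    using car by (simp add: minus_eq_zero_iff)
  moreover have "\<mu> * (hnorm H (x \<ominus>\<^bsub>H\<^esub> x))\<^sup>2 + \<rho> * (hnorm H (u \<ominus>\<^bsub>H\<^esub> v))\<^sup>2
      \<le> ip H (x \<ominus>\<^bsub>H\<^esub> x) (u \<ominus>\<^bsub>H\<^esub> v)"
    using A xu xv by (fastforce simp: AHF semimonotone_class_def semimonotone_def)
  ultimately have "\<rho> * (hnorm H (u \<ominus>\<^bsub>H\<^esub> v))\<^sup>2 \<le> 0"
    using car by (simp add: ip_zero_left hnorm_def)
  moreover have "0 < (hnorm H (u \<ominus>\<^bsub>H\<^esub> v))\<^sup>2"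
    using car \<open>u \<noteq> v\<close> by (simp add: hnorm_eq_zero_iff minus_eq_zero_iff)
  ultimately show ?thesis
    by (simp add: mult_le_0_iff)
qed

section \<open>Operators on copies of Hilbert spaces\<close>

text \<open>
  The structure of a type-class Hilbert space is transported along an injection \<open>f\<close> into the type
  from which the points are drawn, so that \<open>f\<close> becomes an isometry onto the new space.
\<close>

definition hilbert_copy :: "('h::real_inner \<Rightarrow> 'a) \<Rightarrow> 'a hilbert" where
  "hilbert_copy f = \<lparr>carrier = range f, mult = (\<lambda>x y. f 0), one = f 0, zero = f 0,
     add = (\<lambda>x y. f (inv_into UNIV f x + inv_into UNIV f y)),
     smult = (\<lambda>a x. f (a *\<^sub>R inv_into UNIV f x)),
     ip = (\<lambda>x y. inv_into UNIV f x \<bullet> inv_into UNIV f y)\<rparr>"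

lemma hilbert_copy_simps:
  assumes "inj f"
  shows "carrier (hilbert_copy f) = range f"
    and "\<zero>\<^bsub>hilbert_copy f\<^esub> = f 0"
    and "f x \<oplus>\<^bsub>hilbert_copy f\<^esub> f y = f (x + y)"
    and "a \<odot>\<^bsub>hilbert_copy f\<^esub> f x = f (a *\<^sub>R x)"
    and "ip (hilbert_copy f) (f x) (f y) = x \<bullet> y"
    and "hnorm (hilbert_copy f) (f x) = norm x"
  using assms by (simp_all add: hilbert_copy_def hnorm_def norm_eq_sqrt_inner)

lemma real_inner_space_hilbert_copy:
  fixes f :: "'h::real_inner \<Rightarrow> 'a"
  assumes "inj f"
  shows "real_inner_space (hilbert_copy f)"
proof -
  note simps = hilbert_copy_simps[OF assms]
  have inv: "\<exists>y. x + y = 0" for x :: 'h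
    by (rule exI[of _ "- x"]) simp
  have inv_real: "\<exists>y. x + y = 0" for x :: real
    by (rule exI[of _ "- x"]) simp
  have ab: "abelian_group (hilbert_copy f)"
    by (rule abelian_groupI) (auto simp: simps algebra_simps inv inj_eq[OF assms])
  have cr: "cring real_ring"
    by (rule cringI) (auto simp: real_ring_def algebra_simps inv_real
        intro!: abelian_groupI comm_monoidI)
  show ?thesis
    by (intro real_inner_space.intro Module.module.intro ab cr Module.module_axioms.intro
        real_inner_space_axioms.intro)
      (auto simp: simps real_ring_def algebra_simps inner_commute inj_eq[OF assms])
qed

lemma hilbert_copy_minus:
  assumes "inj f"
  shows "f x \<ominus>\<^bsub>hilbert_copy f\<^esub> f y = f (x - y)"
proof -
  interpret real_inner_space "hilbert_copy f"
    by (rule real_inner_space_hilbert_copy[OF assms])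
  show ?thesis
    by (simp add: a_minus_def minus_eq_smult hilbert_copy_simps[OF assms])
qed

text \<open>
  A Cauchy sequence of the copy is the image of a Cauchy sequence of the original space, whose limit
  the isometry \<open>f\<close> carries over.
\<close>

lemma real_hilbert_space_hilbert_copy:
  fixes f :: "'h::{real_inner, complete_space} \<Rightarrow> 'a"
  assumes "inj f"
  shows "real_hilbert_space (hilbert_copy f)"
proof -
  let ?H = "hilbert_copy f"
  interpret real_inner_space ?H
    by (rule real_inner_space_hilbert_copy[OF assms])
  interpret M: Metric_space "carrier ?H" "hdist ?H"
    by (rule Metric_space_hdist)
  have hdist: "hdist ?H (f x) (f y) = dist x y" for x y
    by (simp add: hdist_def hilbert_copy_simps[OF assms] hilbert_copy_minus[OF assms] dist_norm)
  have "\<exists>l. limitin M.mtopology \<sigma> l sequentially" if Cauchy: "M.MCauchy \<sigma>" for \<sigma>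
  proof -
    have "range \<sigma> \<subseteq> range f"
      using Cauchy[unfolded M.MCauchy_def, THEN conjunct1]
      unfolding hilbert_copy_simps(1)[OF assms] .
    then have "\<forall>n. \<exists>x. \<sigma> n = f x"
      by auto
    then obtain s where s: "\<sigma> = (\<lambda>n. f (s n))"
      by metis
    have "Cauchy s"
      using Cauchy[unfolded M.MCauchy_def, THEN conjunct2] by (simp add: s hdist Cauchy_def)
    then obtain l where "s \<longlonglongrightarrow> l"
      using Cauchy_convergent_iff convergent_def by blast
    then have "limitin M.mtopology \<sigma> (f l) sequentially"
      unfolding M.limitin_metric_dist_null s hdist
      by (simp add: hilbert_copy_simps[OF assms] tendsto_dist_iff[THEN iffD1])
    then show ?thesis ..
  qed
  then have "M.mcomplete"
    by (simp add: M.mcomplete_def)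
  then show ?thesis
    by unfold_locales
qed

text \<open>
  Operators on the original space are given by their graphs \<open>R\<close>, since the witnesses for the
  points of the scaled relative graph are finite sets of pairs.
\<close>

definition operator_copy :: "('h::real_inner \<Rightarrow> 'a) \<Rightarrow> ('h \<times> 'h) set \<Rightarrow> 'a operator" where
  "operator_copy f R = (hilbert_copy f, \<lambda>x. {f b | b. (inv_into UNIV f x, b) \<in> R})"

lemma gph_operator_copy:
  assumes "inj f"
  shows "gph (operator_copy f R) = map_prod f f ` R"
  using assms by (auto simp: gph_def operator_copy_def hilbert_copy_simps inj_eq intro: rev_image_eqI)

lemma operator_copy_in_semimonotone_class:
  fixes f :: "'h::{real_inner, complete_space} \<Rightarrow> 'a"
  assumes "inj f"
    and "\<And>x u y v. (x, u) \<in> R \<Longrightarrow> (y, v) \<in> R \<Longrightarrow>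
      \<mu> * (norm (x - y))\<^sup>2 + \<rho> * (norm (u - v))\<^sup>2 \<le> (x - y) \<bullet> (u - v)"
  shows "operator_copy f R \<in> semimonotone_class \<mu> \<rho>"
proof -
  have "operator_copy f R \<in> operators"
    by (auto simp: operators_def operator_copy_def hilbert_copy_simps[OF assms(1)]
        real_hilbert_space_hilbert_copy[OF assms(1)])
  moreover have "semimonotone \<mu> \<rho> (operator_copy f R)"
    using assms(2) gph_operator_copy[OF assms(1), of R]
    by (auto simp: semimonotone_def operator_copy_def hilbert_copy_simps[OF assms(1)]
        hilbert_copy_minus[OF assms(1)])
  ultimately show ?thesis
    by (simp add: semimonotone_class_def)
qed

lemma None_in_SRG_operator_copy:
  assumes "inj f" "(x, u) \<in> R" "(x, v) \<in> R" "u \<noteq> v"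
  shows "None \<in> SRG (operator_copy f R)"
proof -
  have "(f x, f u) \<in> gph (operator_copy f R)" "(f x, f v) \<in> gph (operator_copy f R)" "f u \<noteq> f v"
    using assms by (auto simp: gph_operator_copy inj_eq)
  then show ?thesis
    unfolding SRG_def operator_copy_def by auto
qed

lemma Some_in_SRG_operator_copy:
  assumes "inj f" "(x, u) \<in> R" "(y, v) \<in> R" "x \<noteq> y"
    and "Re z = (x - y) \<bullet> (u - v) / (norm (x - y))\<^sup>2" "cmod z = norm (u - v) / norm (x - y)"
  shows "Some z \<in> SRG (operator_copy f R)"
proof -
  let ?H = "hilbert_copy f"
  interpret real_inner_space ?H
    by (rule real_inner_space_hilbert_copy[OF assms(1)])
  have "z \<in> {z_plus ?H (f (x - y)) (f (u - v)), z_minus ?H (f (x - y)) (f (u - v))}"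
    using assms by (subst z_plus_z_minus_iff) (simp_all add: hilbert_copy_simps inj_eq)
  moreover have "(f x, f u) \<in> gph (operator_copy f R)" "(f y, f v) \<in> gph (operator_copy f R)"
    "f x \<noteq> f y"
    using assms by (auto simp: gph_operator_copy inj_eq)
  ultimately show ?thesis
    unfolding SRG_def operator_copy_def hilbert_copy_minus[OF assms(1), symmetric] by auto
qed

section \<open>The scaled relative graph of the semimonotone operators\<close>

text \<open>The plane has as many points as the line because an infinite set is equipollent to its square.\<close>

lemma complex_lepoll_real: "(UNIV :: complex set) \<lesssim> (UNIV :: real set)"
proof -
  have "(UNIV :: real set) \<times> (UNIV :: real set) \<approx> (UNIV :: real set)"
    unfolding eqpoll_iff_card_of_ordIso
    by (rule card_of_Times_same_infinite) (rule infinite_UNIV_char_0)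
  then have "(UNIV :: (real \<times> real) set) \<lesssim> (UNIV :: real set)"
    by (simp add: eqpoll_imp_lepoll)
  moreover have "inj (\<lambda>z. (Re z, Im z))"
    by (auto intro!: injI simp: complex_eq_iff)
  then have "(UNIV :: complex set) \<lesssim> (UNIV :: (real \<times> real) set)"
    by (auto simp: lepoll_def)
  ultimately show ?thesis
    by (rule lepoll_trans[rotated])
qed

text \<open>
  With \<open>a = 1\<close> and \<open>b = z\<close> in the plane, \<open>\<langle>a, b\<rangle> = Re z\<close> and \<open>\<parallel>b\<parallel> / \<parallel>a\<parallel> = \<bar>z\<bar>\<close>, so the
  inequality on \<open>z\<close> is the semimonotonicity of the graph \<open>{(0, 0), (1, z)}\<close> itself.
\<close>

lemma Some_in_SRG_class_semimonotone_iff: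
  assumes "(UNIV :: real set) \<lesssim> (UNIV :: 'a set)"
  shows "Some z \<in> SRG_class (semimonotone_class \<mu> \<rho> :: 'a operator set) \<longleftrightarrow>
    \<mu> + \<rho> * (cmod z)\<^sup>2 \<le> Re z"
proof
  assume "Some z \<in> SRG_class (semimonotone_class \<mu> \<rho> :: 'a operator set)"
  then show "\<mu> + \<rho> * (cmod z)\<^sup>2 \<le> Re z"
    by (auto simp: SRG_class_def intro: Some_in_SRG_semimonotone)
next
  assume z: "\<mu> + \<rho> * (cmod z)\<^sup>2 \<le> Re z"
  obtain f :: "complex \<Rightarrow> 'a" where f: "inj f"
    using lepoll_trans[OF complex_lepoll_real assms] by (auto simp: lepoll_def)
  let ?A = "operator_copy f {(0, 0), (1, z)}"
  have "?A \<in> semimonotone_class \<mu> \<rho>"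
    using f z by (intro operator_copy_in_semimonotone_class) (auto simp: inner_complex_def)
  moreover have "Some z \<in> SRG ?A"
    by (rule Some_in_SRG_operator_copy[OF f, where x = 1 and u = z and y = 0 and v = 0])
      (auto simp: inner_complex_def)
  ultimately show "Some z \<in> SRG_class (semimonotone_class \<mu> \<rho> :: 'a operator set)"
    unfolding SRG_class_def by blast
qed

lemma None_in_SRG_class_semimonotone_iff:
  assumes "(UNIV :: real set) \<lesssim> (UNIV :: 'a set)"
  shows "None \<in> SRG_class (semimonotone_class \<mu> \<rho> :: 'a operator set) \<longleftrightarrow> \<rho> \<le> 0"
proof
  assume "None \<in> SRG_class (semimonotone_class \<mu> \<rho> :: 'a operator set)"
  then show "\<rho> \<le> 0"
    by (auto simp: SRG_class_def intro: None_in_SRG_semimonotone)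
next
  assume "\<rho> \<le> 0"
  obtain f :: "complex \<Rightarrow> 'a" where f: "inj f"
    using lepoll_trans[OF complex_lepoll_real assms] by (auto simp: lepoll_def)
  let ?A = "operator_copy f {(0, 0), (0, 1)}"
  have "?A \<in> semimonotone_class \<mu> \<rho>"
    using f \<open>\<rho> \<le> 0\<close> by (intro operator_copy_in_semimonotone_class) auto
  moreover have "None \<in> SRG ?A"
    by (rule None_in_SRG_operator_copy[OF f, where x = 0 and u = 0 and v = 1]) auto
  ultimately show "None \<in> SRG_class (semimonotone_class \<mu> \<rho> :: 'a operator set)"
    unfolding SRG_class_def by blast
qed

theorem proposition5:
  fixes \<mu> \<rho> c r :: real
  assumes "(UNIV :: real set) \<lesssim> (UNIV :: 'a set)"
    and "\<mu> \<noteq> 0" and "\<rho> \<noteq> 0" and "\<mu> * \<rho> < 1 / 4"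
    and "c = 1 / (2 * \<rho>)" and "r = sqrt (1 - 4 * \<mu> * \<rho>) / (2 * \<bar>\<rho>\<bar>)"
  shows "SRG_class (semimonotone_class \<mu> \<rho> :: 'a operator set) =
    (if \<rho> < 0 then UNIV - Some ` ball (complex_of_real c) r
     else Some ` closure (ball (complex_of_real c) r))"
proof -
  let ?G = "SRG_class (semimonotone_class \<mu> \<rho> :: 'a operator set)"
  have Some_iff: "Some z \<in> ?G \<longleftrightarrow>
      (if \<rho> < 0 then z \<notin> ball (complex_of_real c) r else z \<in> cball (complex_of_real c) r)" for z
    using Some_in_SRG_class_semimonotone_iff[OF assms(1), of z \<mu> \<rho>]
      disk_inequality[OF assms(3-6), of z] by simp
  have None_iff: "None \<in> ?G \<longleftrightarrow> \<rho> < 0"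
    using None_in_SRG_class_semimonotone_iff[OF assms(1), of \<mu> \<rho>] \<open>\<rho> \<noteq> 0\<close> by auto
  have "0 < r"
    using assms by simp
  then have closure: "closure (ball (complex_of_real c) r) = cball (complex_of_real c) r"
    by (rule closure_ball)
  have "w \<in> ?G \<longleftrightarrow> w \<in> (if \<rho> < 0 then UNIV - Some ` ball (complex_of_real c) r
     else Some ` closure (ball (complex_of_real c) r))" for w
    by (cases w) (auto simp: Some_iff None_iff closure simp del: mem_ball mem_cball)
  then show ?thesis
    by blast
qed

end
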